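(* There exist absolute constants $\Psi_1,\Psi_2,\Psi_3>0$ and $\tilde C>0$ such that the following holds. Let $P_*\in\mathcal N(n,K_*,L_* )$, with parameters satisfying Assumptions A1 and A2, and let $A$ be generated from $P_*$ as in the network model. Put $$\overline{\mathrm{Pen}}(K,L)=\Psi_1nK+\Psi_2K^2\ln n+\Psi_3 n\ln K .$$ Let $(\hat z,\hat c,\hat K,\hat L)$ minimize $$\sum_{l=1}^{L}\sum_{k=1}^{K}\big\|A^{(l,k)}(z,c)-\Pi_{(1)}\big(A^{(l,k)}(z,c)\big)\big\|_F^2+\overline{\mathrm{Pen}}(K,L)$$ over $1\le L\le K\le n$, $z:\{1,\dots,n\}\to\{1,\dots,K\}$ and $c:\{1,\dots,K\}\to\{1,\dots,L\}$. Define $\hat P\in\mathbb R^{n\times n}$ by requiring that, for every $l\le\hat L$ and $k\le\hat K$, its submatrix with rows $J_l(\hat z,\hat c)$ and columns $I_k(\hat z)$ equals $\Pi_{(1)}\big(A^{(l,k)}(\hat z,\hat c)\big)$. Then for every $t>0$ $$\mathbb P\Big\{\|\hat P-P_*\|_F^2\le\tilde C\big[\overline{\mathrm{Pen}}(K_*,L_* )+t\big]\Big\}\ge 1-3e^{-t},$$ and $$\mathbb E\|\hat P-P_*\|_F^2\le\tilde C\big[\overline{\mathrm{Pen}}(K_*,L_* )+3\big].$$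
   Context: Network model: $n\ge 2$ nodes; $P_*\in[0,1]^{n\times n}$ is symmetric; $A\in\{0,1\}^{n\times n}$ is symmetric with entries $A_{ij}$, $1\le i\le j\le n$, independent, $A_{ij}\sim\mathrm{Bernoulli}((P_* )_{ij})$, and $A_{ji}=A_{ij}$. Nested Block Model class: for integers $1\le L\le K\le n$, $\mathcal N(n,K,L)$ is the set of matrices $P\in[0,1]^{n\times n}$ for which there exist a clustering function $z:\{1,\dots,n\}\to\{1,\dots,K\}$ (communities), a clustering function $c:\{1,\dots,K\}\to\{1,\dots,L\}$ (meta-communities), a matrix $B\in[0,1]^{K\times K}$ and a matrix $H\in\mathbb R_+^{n\times L}$ such that, with $n_k=\#\{i:z(i)=k\}$, $$\sum_{i:\,z(i)=k}H_{i,l}=n_k\quad\text{for all }k\le K,\ l\le L,$$ and $$P_{ij}=B_{z(i),z(j)}\,H_{i,c(z(j))}\,H_{j,c(z(i))}\quad\text{for all }i,j.$$ For such a representation, $h^{(k,l)}\in\mathbb R_+^{n_k}$ denotes the subvector $(H_{i,l})_{i:\,z(i)=k}$. Assumptions on the true matrix $P_*\in\mathcal N(n,K_*,L_* )$ with representation $(z_*,c_*,B,H)$: - A1: $B$ is nonsingular with smallest singular value at least $\lambda_0>0$. - A2: for each $k=1,\dots,K_*$, the vectors $h^{(k,l)}$, $l=1,\dots,L_*$, are linearly independent. Blocks: for $z:\{1,\dots,n\}\to\{1,\dots,K\}$ and $c:\{1,\dots,K\}\to\{1,\dots,L\}$, set $$I_k(z)=\{i:z(i)=k\},\qquad J_l(z,c)=\{j:c(z(j))=l\}.$$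 For a matrix $M\in\mathbb R^{n\times n}$, $M^{(l,k)}(z,c)$ is the submatrix of $M$ with rows indexed by $J_l(z,c)$ and columns indexed by $I_k(z)$. For any real matrix $M$, $\Pi_{(1)}(M)=\sigma_1u_1v_1^T$ is its best rank-one approximation (in Frobenius norm), where $\sigma_1$ is the largest singular value of $M$ and $u_1,v_1$ are corresponding unit singular vectors. *)

theory Defs
  imports "HOL-Probability.Probability"
begin

text \<open>Conventions: nodes are indexed by 0..n-1, communities by 0..K-1, meta-communities
by 0..L-1 (a relabelling of the 1-based indices of the paper). Matrices are functions
nat \<Rightarrow> nat \<Rightarrow> real; only entries with indices in range are ever used.\<close>

definition upper_pairs :: "nat \<Rightarrow> (nat \<times> nat) set" where
  "upper_pairs n = {(i, j). i \<le> j \<and> j < n}"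

definition edge_pmf :: "nat \<Rightarrow> (nat \<Rightarrow> nat \<Rightarrow> real) \<Rightarrow> (nat \<times> nat \<Rightarrow> bool) pmf" where
  "edge_pmf n P = Pi_pmf (upper_pairs n) False (\<lambda>(i, j). bernoulli_pmf (P i j))"

definition adj :: "(nat \<times> nat \<Rightarrow> bool) \<Rightarrow> nat \<Rightarrow> nat \<Rightarrow> real" where
  "adj X i j = (if X (min i j, max i j) then 1 else 0)"

definition nbm_repr ::
  "nat \<Rightarrow> nat \<Rightarrow> nat \<Rightarrow> (nat \<Rightarrow> nat \<Rightarrow> real) \<Rightarrow> (nat \<Rightarrow> nat) \<Rightarrow> (nat \<Rightarrow> nat)
    \<Rightarrow> (nat \<Rightarrow> nat \<Rightarrow> real) \<Rightarrow> (nat \<Rightarrow> nat \<Rightarrow> real) \<Rightarrow> bool" where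
  "nbm_repr n K L P z c B H \<longleftrightarrow>
     1 \<le> L \<and> L \<le> K \<and> K \<le> n \<and>
     (\<forall>i<n. \<forall>j<n. 0 \<le> P i j \<and> P i j \<le> 1) \<and>
     (\<forall>i<n. z i < K) \<and> (\<forall>k<K. c k < L) \<and>
     (\<forall>k<K. \<forall>k'<K. 0 \<le> B k k' \<and> B k k' \<le> 1) \<and>
     (\<forall>i<n. \<forall>l<L. 0 \<le> H i l) \<and>
     (\<forall>k<K. \<forall>l<L. (\<Sum>i\<in>{i. i < n \<and> z i = k}. H i l) = real (card {i. i < n \<and> z i = k})) \<and>
     (\<forall>i<n. \<forall>j<n. P i j = B (z i) (z j) * H i (c (z j)) * H j (c (z i)))"

definition smallest_sv_ge :: "nat \<Rightarrow> (nat \<Rightarrow> nat \<Rightarrow> real) \<Rightarrow> real \<Rightarrow> bool" where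
  "smallest_sv_ge K B lam0 \<longleftrightarrow>
     (\<forall>x :: nat \<Rightarrow> real. lam0 * sqrt (\<Sum>k<K. (x k)\<^sup>2) \<le> sqrt (\<Sum>k<K. (\<Sum>j<K. B k j * x j)\<^sup>2))"

definition lin_indep_h ::
  "nat \<Rightarrow> nat \<Rightarrow> nat \<Rightarrow> (nat \<Rightarrow> nat) \<Rightarrow> (nat \<Rightarrow> nat \<Rightarrow> real) \<Rightarrow> bool" where
  "lin_indep_h n K L z H \<longleftrightarrow>
     (\<forall>k<K. \<forall>\<alpha> :: nat \<Rightarrow> real.
        (\<forall>i<n. z i = k \<longrightarrow> (\<Sum>l<L. \<alpha> l * H i l) = 0) \<longrightarrow> (\<forall>l<L. \<alpha> l = 0))"

definition Iblk :: "nat \<Rightarrow> (nat \<Rightarrow> nat) \<Rightarrow> nat \<Rightarrow> nat set" where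
  "Iblk n z k = {i. i < n \<and> z i = k}"

definition Jblk :: "nat \<Rightarrow> (nat \<Rightarrow> nat) \<Rightarrow> (nat \<Rightarrow> nat) \<Rightarrow> nat \<Rightarrow> nat set" where
  "Jblk n z c l = {j. j < n \<and> c (z j) = l}"

definition frob2_blk :: "nat set \<Rightarrow> nat set \<Rightarrow> (nat \<Rightarrow> nat \<Rightarrow> real) \<Rightarrow> (nat \<Rightarrow> nat \<Rightarrow> real) \<Rightarrow> real" where
  "frob2_blk R C M N = (\<Sum>i\<in>R. \<Sum>j\<in>C. (M i j - N i j)\<^sup>2)"

definition is_best_rank1 :: "(nat \<Rightarrow> nat \<Rightarrow> real) \<Rightarrow> nat set \<Rightarrow> nat set \<Rightarrow> (nat \<Rightarrow> nat \<Rightarrow> real) \<Rightarrow> bool" where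
  "is_best_rank1 M R C Q \<longleftrightarrow>
     (\<exists>a b :: nat \<Rightarrow> real. \<forall>i\<in>R. \<forall>j\<in>C. Q i j = a i * b j) \<and>
     (\<forall>a b :: nat \<Rightarrow> real. frob2_blk R C M Q \<le> frob2_blk R C M (\<lambda>i j. a i * b j))"

definition rank1_err :: "(nat \<Rightarrow> nat \<Rightarrow> real) \<Rightarrow> nat set \<Rightarrow> nat set \<Rightarrow> real" where
  "rank1_err M R C = (INF ab \<in> (UNIV :: ((nat \<Rightarrow> real) \<times> (nat \<Rightarrow> real)) set).
                        frob2_blk R C M (\<lambda>i j. fst ab i * snd ab j))"

definition pen :: "real \<Rightarrow> real \<Rightarrow> real \<Rightarrow> nat \<Rightarrow> nat \<Rightarrow> nat \<Rightarrow> real" where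
  "pen \<Psi>1 \<Psi>2 \<Psi>3 n K L = \<Psi>1 * real n * real K + \<Psi>2 * (real K)\<^sup>2 * ln (real n) + \<Psi>3 * real n * ln (real K)"

definition admissible :: "nat \<Rightarrow> (nat \<Rightarrow> nat) \<Rightarrow> (nat \<Rightarrow> nat) \<Rightarrow> nat \<Rightarrow> nat \<Rightarrow> bool" where
  "admissible n z c K L \<longleftrightarrow> 1 \<le> L \<and> L \<le> K \<and> K \<le> n \<and> (\<forall>i<n. z i < K) \<and> (\<forall>k<K. c k < L)"

definition crit :: "real \<Rightarrow> real \<Rightarrow> real \<Rightarrow> nat \<Rightarrow> (nat \<Rightarrow> nat \<Rightarrow> real)
    \<Rightarrow> (nat \<Rightarrow> nat) \<Rightarrow> (nat \<Rightarrow> nat) \<Rightarrow> nat \<Rightarrow> nat \<Rightarrow> real" where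
  "crit \<Psi>1 \<Psi>2 \<Psi>3 n A z c K L =
     (\<Sum>l<L. \<Sum>k<K. rank1_err A (Jblk n z c l) (Iblk n z k)) + pen \<Psi>1 \<Psi>2 \<Psi>3 n K L"

definition is_minimizer :: "real \<Rightarrow> real \<Rightarrow> real \<Rightarrow> nat \<Rightarrow> (nat \<Rightarrow> nat \<Rightarrow> real)
    \<Rightarrow> (nat \<Rightarrow> nat) \<Rightarrow> (nat \<Rightarrow> nat) \<Rightarrow> nat \<Rightarrow> nat \<Rightarrow> bool" where
  "is_minimizer \<Psi>1 \<Psi>2 \<Psi>3 n A z c K L \<longleftrightarrow>
     admissible n z c K L \<and>
     (\<forall>z' c' K' L'. admissible n z' c' K' L' \<longrightarrow>
        crit \<Psi>1 \<Psi>2 \<Psi>3 n A z c K L \<le> crit \<Psi>1 \<Psi>2 \<Psi>3 n A z' c' K' L')"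

definition is_blockwise_rank1 :: "nat \<Rightarrow> (nat \<Rightarrow> nat \<Rightarrow> real) \<Rightarrow> (nat \<Rightarrow> nat) \<Rightarrow> (nat \<Rightarrow> nat)
    \<Rightarrow> nat \<Rightarrow> nat \<Rightarrow> (nat \<Rightarrow> nat \<Rightarrow> real) \<Rightarrow> bool" where
  "is_blockwise_rank1 n A z c K L Q \<longleftrightarrow>
     (\<forall>l<L. \<forall>k<K. is_best_rank1 A (Jblk n z c l) (Iblk n z k) Q)"

definition frob2 :: "nat \<Rightarrow> (nat \<Rightarrow> nat \<Rightarrow> real) \<Rightarrow> (nat \<Rightarrow> nat \<Rightarrow> real) \<Rightarrow> real" where
  "frob2 n M N = (\<Sum>i<n. \<Sum>j<n. (M i j - N i j)\<^sup>2)"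

end

theory Submission
  imports Defs
begin

text \<open>
  Write \<open>\<Xi> = A - P\<close>. Comparing the criterion at the minimiser and at the true clustering gives
  \<open>|R - P|\<^sup>2 \<le> 2 \<langle>\<Xi>, R - P\<rangle> + pen(true) - pen(estimated)\<close> for the estimator \<open>R\<close>, so everything
  rests on the noise term.

  For each clustering fix a deterministic, nearly best blockwise rank-one approximation \<open>Q\<close> of \<open>P\<close>.
  Then \<open>R - P = (Q - P) + M1 + M2\<close> with \<open>M1\<close>, \<open>M2\<close> blockwise rank one and orthogonal, all three of
  norm controlled by \<open>|R - P|\<close>. A bilinear form is affine in each coordinate of its factors, so the
  factors of \<open>M1\<close> and \<open>M2\<close>, suitably scaled, can be rounded to integer points without decreasing
  \<open>\<langle>\<Xi>, M1 + M2\<rangle>\<close>; this replaces nets and operator norm bounds.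

  The rounded directions are countable. Weighting them by discrete Gaussian weights \<open>w\<close> of total
  mass at most 1, the mixture \<open>W\<close> of the exponentials
  \<open>exp (\<mu> \<langle>\<Xi>, G\<rangle> - \<mu>\<^sup>2 |G|\<^sup>2 / 4)\<close> satisfies \<open>E W \<le> 1\<close> by Hoeffding's lemma, and bounding a single term by
  \<open>W\<close> yields \<open>|R - P|\<^sup>2 \<le> C (pen + ln W)\<close> pointwise. Markov's inequality for \<open>W\<close> gives the tail bound,
  and \<open>ln W \<le> W\<close> the bound in expectation.
\<close>

section \<open>Inner product and squared Frobenius norm of \<open>n\<close> by \<open>n\<close>
  matrices\<close>

definition ip :: "nat \<Rightarrow> (nat \<Rightarrow> nat \<Rightarrow> real) \<Rightarrow> (nat \<Rightarrow> nat \<Rightarrow> real) \<Rightarrow> real" where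
  "ip n M N = (\<Sum>i<n. \<Sum>j<n. M i j * N i j)"

definition nsq :: "nat \<Rightarrow> (nat \<Rightarrow> nat \<Rightarrow> real) \<Rightarrow> real" where
  "nsq n M = (\<Sum>i<n. \<Sum>j<n. (M i j)\<^sup>2)"

lemma power2_add_le: "(a + b)\<^sup>2 \<le> 2 * a\<^sup>2 + 2 * b\<^sup>2" for a b :: real
  using sum_squares_bound[of a b] by (simp add: power2_sum)

lemma nsq_nonneg: "0 \<le> nsq n M"
  unfolding nsq_def by (intro sum_nonneg) auto

lemma nsq_add3:
  "nsq n (\<lambda>i j. M i j + N i j + R i j) \<le> 3 * (nsq n M + nsq n N + nsq n R)"
proof -
  have *: "(a + b + c)\<^sup>2 \<le> 3 * (a\<^sup>2 + b\<^sup>2 + c\<^sup>2)" for a b c :: real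
  proof -
    have "0 \<le> (a - b)\<^sup>2 + (b - c)\<^sup>2 + (a - c)\<^sup>2"
      by simp
    then show ?thesis
      by (simp add: power2_eq_square algebra_simps)
  qed
  have "nsq n (\<lambda>i j. M i j + N i j + R i j)
      \<le> (\<Sum>i<n. \<Sum>j<n. 3 * ((M i j)\<^sup>2 + (N i j)\<^sup>2 + (R i j)\<^sup>2))"
    unfolding nsq_def by (intro sum_mono *)
  also have "\<dots> = 3 * (nsq n M + nsq n N + nsq n R)"
    by (simp add: nsq_def sum.distrib sum_distrib_left distrib_left)
  finally show ?thesis .
qed

lemma frob2_eq_nsq: "frob2 n M N = nsq n (\<lambda>i j. M i j - N i j)"
  by (simp add: frob2_def nsq_def)

subsection \<open>Exponential moments of the noise\<close>

text \<open>Hoeffding's lemma on an interval of length 1. The explicit two-point expectation is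
  bounded for nonnegative \<open>h\<close>; a negative \<open>h\<close> reduces to this by
  exchanging the outcomes, that is, by passing to \<open>1 - p\<close> and
  \<open>- h\<close>.\<close>

lemma bernoulli_centred_mgf:
  fixes p h :: real
  assumes "0 \<le> p" "p \<le> 1"
  shows "measure_pmf.expectation (bernoulli_pmf p) (\<lambda>x. exp (h * ((if x then 1 else 0) - p)))
           \<le> exp (h\<^sup>2 / 8)"
proof -
  have pos: "exp h * q + (1 - q) > 0" if "0 \<le> q" "q \<le> 1" for q h :: real
    using that by (cases "q = 1") (auto intro: add_nonneg_pos)
  have aux: "exp (h * (1 - q)) * q + exp (- (h * q)) * (1 - q) \<le> exp (h\<^sup>2 / 8)"
    if "0 \<le> q" "q \<le> 1" "h \<ge> 0" for q h :: real
  proof -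
    have "exp (h * (1 - q)) * q + exp (- (h * q)) * (1 - q) = exp (- (h * q)) * (exp h * q + (1 - q))"
      by (simp add: distrib_left right_diff_distrib exp_diff exp_minus field_simps)
    also have "\<dots> = exp (- h * q + ln (1 + q * (exp h - 1)))"
      unfolding exp_add using pos[of q h] that by (subst exp_ln) (auto simp: algebra_simps)
    also have "\<dots> \<le> exp (h\<^sup>2 / 8)"
      using Hoeffdings_lemma_aux[of h q] that by simp
    finally show ?thesis .
  qed
  show ?thesis
  proof (cases "h \<ge> 0")
    case True
    then show ?thesis using assms aux[of p h] by simp
  next
    case False
    then show ?thesis using assms aux[of "1 - p" "- h"]
      by (simp add: algebra_simps)
  qed
qed

text \<open>Edges are sampled only on and above the diagonal, so sums over all ordered pairs are
  folded onto these pairs before independence is applied.\<close>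

lemma sum_square_eq_sum_upper:
  "(\<Sum>i<n. \<Sum>j<n. f i j) =
     (\<Sum>(i, j)\<in>upper_pairs n. if i = j then f i i else f i j + f j i :: real)"
proof -
  let ?U = "{(i, j). i < j \<and> j < n}" and ?D = "(\<lambda>i. (i, i)) ` {..<n}"
  have fU: "finite ?U"
    by (rule finite_subset[of _ "{..<n} \<times> {..<n}"]) auto
  have sq: "{..<n} \<times> {..<n} = (?U \<union> prod.swap ` ?U) \<union> ?D"
    by (auto simp: image_iff)
  have up: "upper_pairs n = ?U \<union> ?D"
    by (auto simp: upper_pairs_def)
  have "(\<Sum>i<n. \<Sum>j<n. f i j) = (\<Sum>(i, j)\<in>{..<n} \<times> {..<n}. f i j)"
    by (simp add: sum.cartesian_product)
  also have "\<dots> = (\<Sum>(i, j)\<in>?U. f i j) + (\<Sum>(i, j)\<in>prod.swap ` ?U. f i j) + (\<Sum>(i, j)\<in>?D. f i j)"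
    unfolding sq using fU by (subst sum.union_disjoint; (subst sum.union_disjoint)?) auto
  also have "(\<Sum>(i, j)\<in>prod.swap ` ?U. f i j) = (\<Sum>(i, j)\<in>?U. f j i)"
    by (subst sum.reindex) (auto simp: case_prod_unfold)
  also have "(\<Sum>(i, j)\<in>?U. f i j) + (\<Sum>(i, j)\<in>?U. f j i) + (\<Sum>(i, j)\<in>?D. f i j)
      = (\<Sum>(i, j)\<in>?U. if i = j then f i i else f i j + f j i)
        + (\<Sum>(i, j)\<in>?D. if i = j then f i i else f i j + f j i)"
    unfolding sum.distrib[symmetric]
    by (intro arg_cong2[where f = "(+)"] sum.cong) auto
  also have "\<dots> = (\<Sum>(i, j)\<in>upper_pairs n. if i = j then f i i else f i j + f j i)"
    unfolding up using fU by (subst sum.union_disjoint) auto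
  finally show ?thesis .
qed

lemma finite_upper_pairs: "finite (upper_pairs n)"
  by (rule finite_subset[of _ "{..<n} \<times> {..<n}"]) (auto simp: upper_pairs_def)

text \<open>Finite support makes every real function of the graph integrable, and bounded on the
  support.\<close>

lemma finite_set_edge_pmf: "finite (set_pmf (edge_pmf n P))"
  unfolding edge_pmf_def
  by (rule finite_subset[OF set_Pi_pmf_subset'[OF finite_upper_pairs]])
     (intro finite_PiE_dflt finite_upper_pairs, auto)

text \<open>Off the diagonal, one edge variable carries the coefficient
  \<open>G i j + G j i\<close>. Its square is at most
  \<open>2 * (G i j)\<^sup>2 + 2 * (G j i)\<^sup>2\<close>, which turns Hoeffding's 1/8 into
  1/4.\<close>

lemma noise_mgf:
  assumes sym: "\<forall>i<n. \<forall>j<n. P i j = P j i"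
    and P01: "\<forall>i<n. \<forall>j<n. 0 \<le> P i j \<and> P i j \<le> 1"
  shows "measure_pmf.expectation (edge_pmf n P)
           (\<lambda>X. exp (\<mu> * ip n (\<lambda>i j. adj X i j - P i j) G)) \<le> exp (\<mu>\<^sup>2 * nsq n G / 4)"
proof -
  define g where "g = (\<lambda>(i, j). if i = j then G i i else G i j + G j i)"
  define F where "F = (\<lambda>(i, j) b. exp (\<mu> * g (i, j) * ((if b then 1 else 0) - P i j)))"
  have F_nonneg: "0 \<le> F x b" for x b
    by (auto simp: F_def split: prod.splits)
  have "exp (\<mu> * ip n (\<lambda>i j. adj X i j - P i j) G) = (\<Prod>x\<in>upper_pairs n. F x (X x))" for X
  proof -
    have "ip n (\<lambda>i j. adj X i j - P i j) G
        = (\<Sum>(i, j)\<in>upper_pairs n. g (i, j) * ((if X (i, j) then 1 else 0) - P i j))"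
      unfolding ip_def sum_square_eq_sum_upper
      by (rule sum.cong)
         (use sym in \<open>auto simp: upper_pairs_def g_def adj_def min_def max_def algebra_simps\<close>)
    then show ?thesis
      by (simp add: F_def exp_sum[OF finite_upper_pairs, symmetric] sum_distrib_left
                    case_prod_unfold mult.assoc)
  qed
  then have "measure_pmf.expectation (edge_pmf n P)
               (\<lambda>X. exp (\<mu> * ip n (\<lambda>i j. adj X i j - P i j) G))
      = (\<Prod>x\<in>upper_pairs n. measure_pmf.expectation (case x of (i, j) \<Rightarrow> bernoulli_pmf (P i j)) (F x))"
    unfolding edge_pmf_def
    by (simp, subst expectation_prod_Pi_pmf)
       (auto simp: finite_upper_pairs F_nonneg intro!: integrable_measure_pmf_finite)
  also have "\<dots> \<le> (\<Prod>(i, j)\<in>upper_pairs n. exp ((\<mu> * g (i, j))\<^sup>2 / 8))"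
    using bernoulli_centred_mgf P01
    by (intro prod_mono) (auto simp: F_def upper_pairs_def intro!: Bochner_Integration.integral_nonneg)
  also have "\<dots> = exp (\<mu>\<^sup>2 / 8 * (\<Sum>x\<in>upper_pairs n. (g x)\<^sup>2))"
    by (simp add: exp_sum[OF finite_upper_pairs, symmetric] sum_distrib_left
                  case_prod_unfold power_mult_distrib)
  also have "\<dots> \<le> exp (\<mu>\<^sup>2 / 8 * (2 * nsq n G))"
  proof -
    have "(\<Sum>x\<in>upper_pairs n. (g x)\<^sup>2)
        \<le> (\<Sum>(i, j)\<in>upper_pairs n. if i = j then 2 * (G i i)\<^sup>2 else 2 * (G i j)\<^sup>2 + 2 * (G j i)\<^sup>2)"
      by (rule sum_mono) (auto simp: g_def power2_add_le split: prod.splits)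
    also have "\<dots> = 2 * nsq n G"
      unfolding nsq_def sum_square_eq_sum_upper sum_distrib_left by (rule sum.cong) auto
    finally show ?thesis
      unfolding exp_le_cancel_iff by (intro mult_left_mono) auto
  qed
  finally show ?thesis
    by (simp add: mult.commute)
qed

subsection \<open>The basic inequality\<close>

lemma sum_fibres:
  fixes f :: "nat \<Rightarrow> real"
  assumes "\<forall>i<n. g i < (K::nat)"
  shows "(\<Sum>k<K. \<Sum>i\<in>{i. i < n \<and> g i = k}. f i) = (\<Sum>i<n. f i)"
  using sum.group[of "{..<n}" "{..<K}" g f] assms by (auto simp: image_subset_iff)

text \<open>Every row lies in exactly one \<open>Jblk\<close> and every column in exactly one
  \<open>Iblk\<close>, so the blocks tile the square.\<close>

lemma sum_blocks_frob2:
  assumes "admissible n z c K L"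
  shows "(\<Sum>l<L. \<Sum>k<K. frob2_blk (Jblk n z c l) (Iblk n z k) M N) = frob2 n M N"
proof -
  have z: "\<forall>i<n. z i < K" and cz: "\<forall>i<n. c (z i) < L"
    using assms by (auto simp: admissible_def)
  have "(\<Sum>k<K. frob2_blk (Jblk n z c l) (Iblk n z k) M N)
      = (\<Sum>i\<in>Jblk n z c l. \<Sum>j<n. (M i j - N i j)\<^sup>2)" for l
    unfolding frob2_blk_def by (subst sum.swap) (simp add: Iblk_def sum_fibres[OF z])
  then show ?thesis
    by (simp add: Jblk_def sum_fibres[OF cz, of "\<lambda>i. \<Sum>j<n. (M i j - N i j)\<^sup>2"] frob2_def)
qed

lemma rank1_err_le:
  assumes "\<forall>i\<in>R. \<forall>j\<in>C. N i j = a i * b j"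
  shows "rank1_err M R C \<le> frob2_blk R C M N"
proof -
  have "rank1_err M R C \<le> frob2_blk R C M (\<lambda>i j. fst (a, b) i * snd (a, b) j)"
    unfolding rank1_err_def
    by (rule cINF_lower) (auto intro!: bdd_belowI[of _ 0] sum_nonneg simp: frob2_blk_def)
  also have "\<dots> = frob2_blk R C M N"
    using assms by (simp add: frob2_blk_def)
  finally show ?thesis .
qed

lemma frob2_blk_best_le_rank1_err:
  assumes "is_best_rank1 M R C Q"
  shows "frob2_blk R C M Q \<le> rank1_err M R C"
  unfolding rank1_err_def using assms by (intro cINF_greatest) (auto simp: is_best_rank1_def)

text \<open>\<open>P\<close> is itself rank one on each block of its own clustering, so its error
  bounds the criterion there. Expanding \<open>frob2 n A Q\<close> around \<open>P\<close> then
  cancels \<open>frob2 n A P\<close> and leaves the cross term and the penalties.\<close>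

lemma penalised_least_squares:
  assumes min: "is_minimizer \<Psi>1 \<Psi>2 \<Psi>3 n A z c K L"
    and Q: "is_blockwise_rank1 n A z c K L Q"
    and P: "nbm_repr n K' L' P z' c' B H"
  shows "frob2 n Q P \<le> 2 * ip n (\<lambda>i j. A i j - P i j) (\<lambda>i j. Q i j - P i j)
           + pen \<Psi>1 \<Psi>2 \<Psi>3 n K' L' - pen \<Psi>1 \<Psi>2 \<Psi>3 n K L"
proof -
  have adm: "admissible n z c K L"
    using min by (simp add: is_minimizer_def)
  have adm': "admissible n z' c' K' L'"
    using P by (auto simp: nbm_repr_def admissible_def)
  have "frob2 n A Q + pen \<Psi>1 \<Psi>2 \<Psi>3 n K L \<le> crit \<Psi>1 \<Psi>2 \<Psi>3 n A z c K L"
    unfolding sum_blocks_frob2[OF adm, symmetric] crit_def using Q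
    by (auto intro!: sum_mono frob2_blk_best_le_rank1_err simp: is_blockwise_rank1_def)
  also have "\<dots> \<le> crit \<Psi>1 \<Psi>2 \<Psi>3 n A z' c' K' L'"
    using min adm' by (auto simp: is_minimizer_def)
  also have "\<dots> \<le> frob2 n A P + pen \<Psi>1 \<Psi>2 \<Psi>3 n K' L'"
    unfolding sum_blocks_frob2[OF adm', symmetric] crit_def
  proof (intro add_mono sum_mono order_refl)
    fix l k
    \<comment> \<open>In this block \<open>z' j = k\<close> and \<open>c' (z' i) = l\<close>, so
      \<open>P i j\<close> separates into a function of \<open>i\<close> times a function of
      \<open>j\<close>.\<close>
    show "rank1_err A (Jblk n z' c' l) (Iblk n z' k) \<le> frob2_blk (Jblk n z' c' l) (Iblk n z' k) A P"
      by (rule rank1_err_le[where a = "\<lambda>i. B (z' i) k * H i (c' k)" and b = "\<lambda>j. H j l"])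
         (use P in \<open>auto simp: nbm_repr_def Jblk_def Iblk_def\<close>)
  qed
  also have "frob2 n A Q = frob2 n A P - 2 * ip n (\<lambda>i j. A i j - P i j) (\<lambda>i j. Q i j - P i j)
      + frob2 n Q P"
    by (simp add: frob2_def ip_def sum_subtractf[symmetric] sum.distrib[symmetric] sum_distrib_left
                  power2_eq_square algebra_simps)
  finally show ?thesis
    by simp
qed

subsection \<open>Blockwise rank-one matrices\<close>

text \<open>Row \<open>i\<close> determines its meta-community and column \<open>j\<close> its
  community, so the factor pairs of all blocks can be stored together in two arrays.\<close>

definition block_rank1 ::
  "nat \<Rightarrow> (nat \<Rightarrow> nat) \<Rightarrow> (nat \<Rightarrow> nat) \<Rightarrow> (nat \<Rightarrow> nat \<Rightarrow> real) \<Rightarrow> bool" where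
  "block_rank1 n z c M \<longleftrightarrow>
     (\<exists>\<alpha> \<beta>. \<forall>i<n. \<forall>j<n. M i j = \<alpha> i (z j) * \<beta> j (c (z i)))"

text \<open>Restriction makes both maps extensional, hence members of the finite function spaces
  that \<open>configs\<close> ranges over.\<close>

lemma is_blockwise_rank1_imp_block_rank1:
  assumes adm: "admissible n z c K L" and Q: "is_blockwise_rank1 n A z c K L Q"
  shows "block_rank1 n (restrict z {..<n}) (restrict c {..<K}) Q"
proof -
  have "\<forall>l\<in>{..<L}. \<forall>k\<in>{..<K}. \<exists>a b. \<forall>i\<in>Jblk n z c l. \<forall>j\<in>Iblk n z k. Q i j = a i * b j"
    using Q by (auto simp: is_blockwise_rank1_def is_best_rank1_def)
  then obtain a b where ab: "\<forall>l\<in>{..<L}. \<forall>k\<in>{..<K}. \<forall>i\<in>Jblk n z c l. \<forall>j\<in>Iblk n z k.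
      Q i j = a l k i * b l k j"
    unfolding bchoice_iff by blast
  have "Q i j = a (c (z i)) (z j) i * b (c (z i)) (z j) j" if "i < n" "j < n" for i j
    using ab that adm by (auto simp: admissible_def Jblk_def Iblk_def)
  then show ?thesis
    unfolding block_rank1_def using adm
    by (intro exI[of _ "\<lambda>i k. a (c (z i)) k i"] exI[of _ "\<lambda>j l. b l (z j) j"])
       (auto simp: admissible_def)
qed

text \<open>In each block, the second left factor is orthogonalised against the first.\<close>

lemma block_rank1_diff_split:
  assumes M: "block_rank1 n z c M" and N: "block_rank1 n z c N"
  obtains M1 M2 where "block_rank1 n z c M1" "block_rank1 n z c M2"
    "\<forall>i<n. \<forall>j<n. M i j - N i j = M1 i j + M2 i j"
    "nsq n M1 + nsq n M2 = nsq n (\<lambda>i j. M i j - N i j)"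
proof -
  obtain a1 b1 where ab1: "\<forall>i<n. \<forall>j<n. M i j = a1 i (z j) * b1 j (c (z i))"
    using M by (auto simp: block_rank1_def)
  obtain a2 b2 where ab2: "\<forall>i<n. \<forall>j<n. N i j = a2 i (z j) * b2 j (c (z i))"
    using N by (auto simp: block_rank1_def)
  \<comment> \<open>Gram-Schmidt coefficient of \<open>a2\<close> along \<open>a1\<close> within a
    block. If \<open>a1\<close> vanishes there, the quotient is 0 by convention and orthogonality is
    trivial.\<close>
  define s where "s l k = (\<Sum>i\<in>Jblk n z c l. a1 i k * a2 i k) / (\<Sum>i\<in>Jblk n z c l. (a1 i k)\<^sup>2)" for l k
  define r where "r i k = a2 i k - s (c (z i)) k * a1 i k" for i k
  define M1 where "M1 i j = a1 i (z j) * (b1 j (c (z i)) - s (c (z i)) (z j) * b2 j (c (z i)))" for i j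
  define M2 where "M2 i j = r i (z j) * (- b2 j (c (z i)))" for i j
  have fin: "finite (Jblk n z c l)" for l
    by (simp add: Jblk_def)
  have orth: "(\<Sum>i\<in>Jblk n z c l. a1 i k * r i k) = 0" for l k
  proof -
    have "(\<Sum>i\<in>Jblk n z c l. a1 i k * r i k)
        = (\<Sum>i\<in>Jblk n z c l. a1 i k * a2 i k) - s l k * (\<Sum>i\<in>Jblk n z c l. (a1 i k)\<^sup>2)"
      unfolding sum_distrib_left sum_subtractf[symmetric]
      by (rule sum.cong) (auto simp: r_def Jblk_def algebra_simps power2_eq_square)
    also have "\<dots> = 0"
    proof (cases "(\<Sum>i\<in>Jblk n z c l. (a1 i k)\<^sup>2) = 0")
      case True
      then have "\<forall>i\<in>Jblk n z c l. a1 i k = 0"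
        by (subst (asm) sum_nonneg_eq_0_iff) (auto simp: fin)
      then show ?thesis by simp
    next
      case False
      then show ?thesis by (simp add: s_def)
    qed
    finally show ?thesis .
  qed
  have eq: "\<forall>i<n. \<forall>j<n. M i j - N i j = M1 i j + M2 i j"
    using ab1 ab2 by (auto simp: M1_def M2_def r_def algebra_simps)
  \<comment> \<open>Orthogonality lives in the left factors, so the cross terms cancel within each
    column once its rows are grouped by meta-community.\<close>
  have col: "(\<Sum>i<n. M1 i j * M2 i j) = 0" for j
  proof -
    let ?f = "\<lambda>i. M1 i j * M2 i j"
    have "(\<Sum>i<n. ?f i) = (\<Sum>l\<in>(\<lambda>i. c (z i)) ` {..<n}. \<Sum>i\<in>{i\<in>{..<n}. c (z i) = l}. ?f i)"
      by (rule sum.image_gen) simp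
    also have "\<dots> = (\<Sum>l\<in>(\<lambda>i. c (z i)) ` {..<n}. (b1 j l - s l (z j) * b2 j l) * (- b2 j l)
        * (\<Sum>i\<in>Jblk n z c l. a1 i (z j) * r i (z j)))"
      by (rule sum.cong) (auto simp: Jblk_def sum_distrib_left M1_def M2_def intro!: sum.cong)
    finally show ?thesis by (simp add: orth)
  qed
  have "nsq n (\<lambda>i j. M i j - N i j) = (\<Sum>i<n. \<Sum>j<n. (M1 i j + M2 i j)\<^sup>2)"
    using eq by (simp add: nsq_def)
  also have "\<dots> = nsq n M1 + nsq n M2 + 2 * (\<Sum>i<n. \<Sum>j<n. M1 i j * M2 i j)"
    by (simp add: nsq_def power2_sum sum.distrib sum_distrib_left mult.assoc)
  also have "(\<Sum>i<n. \<Sum>j<n. M1 i j * M2 i j) = 0"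
    by (subst sum.swap) (simp add: col)
  finally have "nsq n M1 + nsq n M2 = nsq n (\<lambda>i j. M i j - N i j)" by simp
  moreover have "block_rank1 n z c M1" "block_rank1 n z c M2"
    unfolding block_rank1_def M1_def M2_def
    by (intro exI[of _ a1] exI[of _ "\<lambda>j l. b1 j l - s l (z j) * b2 j l"], simp)
       (intro exI[of _ r] exI[of _ "\<lambda>j l. - b2 j l"], simp)
  ultimately show ?thesis using that eq by blast
qed

text \<open>
  The factor \<open>Y\<close> has average squared entry at most 1 on each community, so that rounding it to
  integers at most quadruples the bound on its norm.
\<close>

lemma block_rank1_normalise:
  assumes M: "block_rank1 n z c M" and z: "\<forall>i<n. z i < K"
  obtains X Y where
    "\<forall>i<n. \<forall>j<n. M i j = X i (z j) * Y j (c (z i)) / sqrt (card (Iblk n z (z j)))"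
    "(\<Sum>i<n. \<Sum>k<K. (X i k)\<^sup>2) = nsq n M"
    "\<forall>k l. (\<Sum>j\<in>Iblk n z k. (Y j l)\<^sup>2) \<le> card (Iblk n z k)"
proof -
  obtain a b where ab: "\<forall>i<n. \<forall>j<n. M i j = a i (z j) * b j (c (z i))"
    using M by (auto simp: block_rank1_def)
  \<comment> \<open>The norm \<open>w\<close> of the right factor on a block is moved into
    \<open>X\<close>, which then carries the whole norm of \<open>M\<close>. Where \<open>w\<close>
    is 0, so is \<open>b\<close>, and the factorisation survives the division by zero.\<close>
  define w where "w l k = sqrt (\<Sum>j\<in>Iblk n z k. (b j l)\<^sup>2)" for l k
  define X where "X i k = a i k * w (c (z i)) k" for i k
  define Y where "Y j l = b j l / w l (z j) * sqrt (card (Iblk n z (z j)))" for j l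
  have fin: "finite (Iblk n z k)" for k
    by (simp add: Iblk_def)
  have w2: "(w l k)\<^sup>2 = (\<Sum>j\<in>Iblk n z k. (b j l)\<^sup>2)" for l k
    by (simp add: w_def sum_nonneg)
  have w0: "b j l = 0" if "w l (z j) = 0" "j < n" for j l
    using that by (auto simp: w_def Iblk_def sum_nonneg_eq_0_iff)
  have card0: "card (Iblk n z (z j)) \<noteq> 0" if "j < n" for j
    using that fin by (auto simp: Iblk_def)
  show ?thesis
  proof
    show "\<forall>i<n. \<forall>j<n. M i j = X i (z j) * Y j (c (z i)) / sqrt (card (Iblk n z (z j)))"
    proof (intro allI impI)
      fix i j assume "i < n" "j < n"
      then show "M i j = X i (z j) * Y j (c (z i)) / sqrt (card (Iblk n z (z j)))"
        using ab card0[of j] w0[of "c (z i)" j] by (cases "w (c (z i)) (z j) = 0") (auto simp: X_def Y_def)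
    qed
    show "(\<Sum>i<n. \<Sum>k<K. (X i k)\<^sup>2) = nsq n M"
      unfolding nsq_def
    proof (rule sum.cong)
      fix i assume "i \<in> {..<n}"
      then have "(\<Sum>j<n. (M i j)\<^sup>2) = (\<Sum>j<n. (a i (z j) * b j (c (z i)))\<^sup>2)"
        using ab by simp
      also have "\<dots> = (\<Sum>k<K. \<Sum>j\<in>Iblk n z k. (a i (z j) * b j (c (z i)))\<^sup>2)"
        unfolding Iblk_def by (rule sum_fibres[OF z, symmetric])
      also have "\<dots> = (\<Sum>k<K. (X i k)\<^sup>2)"
        by (rule sum.cong)
           (auto simp: X_def power_mult_distrib w2 sum_distrib_left Iblk_def intro!: sum.cong)
      finally show "(\<Sum>k<K. (X i k)\<^sup>2) = (\<Sum>j<n. (M i j)\<^sup>2)" by simp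
    qed simp
    show "\<forall>k l. (\<Sum>j\<in>Iblk n z k. (Y j l)\<^sup>2) \<le> card (Iblk n z k)"
    proof (intro allI)
      fix k l
      have "(\<Sum>j\<in>Iblk n z k. (Y j l)\<^sup>2)
          = (\<Sum>j\<in>Iblk n z k. card (Iblk n z k) / (w l k)\<^sup>2 * (b j l)\<^sup>2)"
        by (rule sum.cong) (auto simp: Y_def Iblk_def power_mult_distrib power_divide)
      also have "\<dots> = card (Iblk n z k) / (w l k)\<^sup>2 * (w l k)\<^sup>2"
        by (simp add: w2 sum_distrib_left)
      also have "\<dots> \<le> card (Iblk n z k)" by simp
      finally show "(\<Sum>j\<in>Iblk n z k. (Y j l)\<^sup>2) \<le> card (Iblk n z k)" .
    qed
  qed
qed

subsection \<open>Rounding to the integer lattice\<close>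

definition lattice_matrix ::
  "nat \<Rightarrow> (nat \<Rightarrow> nat) \<Rightarrow> (nat \<Rightarrow> nat) \<Rightarrow> (nat \<times> nat \<Rightarrow> int) \<Rightarrow> (nat \<times> nat \<Rightarrow> int) \<Rightarrow> nat \<Rightarrow> nat \<Rightarrow> real"
  where "lattice_matrix n z c U V i j =
     real_of_int (U (i, z j)) * real_of_int (V (j, c (z i))) / sqrt (card (Iblk n z (z j)))"

definition int_box :: "nat \<Rightarrow> nat \<Rightarrow> nat \<Rightarrow> (nat \<times> nat \<Rightarrow> int) set" where
  "int_box m n K = {..<n} \<times> {..<K} \<rightarrow>\<^sub>E {- int m..int m}"

definition sumsq :: "nat \<Rightarrow> nat \<Rightarrow> (nat \<times> nat \<Rightarrow> int) \<Rightarrow> real" where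
  "sumsq n K U = (\<Sum>x\<in>{..<n} \<times> {..<K}. (real_of_int (U x))\<^sup>2)"

lemma sumsq_eq: "sumsq n K U = (\<Sum>i<n. \<Sum>k<K. (real_of_int (U (i, k)))\<^sup>2)"
  by (simp add: sumsq_def sum.cartesian_product case_prod_unfold)

text \<open>A linear form does not decrease if each entry is rounded up when its coefficient is
  nonnegative and down otherwise. All \<open>j\<close> with \<open>g j = k\<close> share the entry
  \<open>X i k\<close>, so its coefficient is the sum of theirs.\<close>

lemma round_by_coefficient_sign:
  fixes X C :: "nat \<Rightarrow> nat \<Rightarrow> real"
  assumes g: "\<forall>j<n. g j < K"
  obtains U :: "nat \<times> nat \<Rightarrow> int" where
    "\<forall>x\<in>{..<n} \<times> {..<K}. \<bar>real_of_int (U x) - X (fst x) (snd x)\<bar> \<le> 1"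
    "(\<Sum>i<n. \<Sum>j<n. C i j * X i (g j)) \<le> (\<Sum>i<n. \<Sum>j<n. C i j * real_of_int (U (i, g j)))"
    "U \<in> extensional ({..<n} \<times> {..<K})"
proof -
  define s where "s i k = (\<Sum>j\<in>{j. j < n \<and> g j = k}. C i j)" for i k
  define U where "U = (\<lambda>x\<in>{..<n} \<times> {..<K}.
    if s (fst x) (snd x) \<ge> 0 then \<lceil>X (fst x) (snd x)\<rceil> else \<lfloor>X (fst x) (snd x)\<rfloor>)"
  have collect: "(\<Sum>j<n. C i j * x (g j)) = (\<Sum>k<K. s i k * x k)" for i and x :: "nat \<Rightarrow> real"
  proof -
    have "(\<Sum>j<n. C i j * x (g j)) = (\<Sum>k<K. \<Sum>j\<in>{j. j < n \<and> g j = k}. C i j * x (g j))"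
      by (rule sum_fibres[OF g, symmetric])
    also have "\<dots> = (\<Sum>k<K. s i k * x k)"
      by (rule sum.cong) (auto simp: s_def sum_distrib_right intro!: sum.cong)
    finally show ?thesis .
  qed
  have "\<bar>real_of_int (U x) - X (fst x) (snd x)\<bar> \<le> 1" if "x \<in> {..<n} \<times> {..<K}" for x
    using that unfolding U_def by auto linarith+
  moreover have "(\<Sum>i<n. \<Sum>j<n. C i j * X i (g j)) \<le> (\<Sum>i<n. \<Sum>j<n. C i j * real_of_int (U (i, g j)))"
  proof (rule sum_mono)
    fix i assume i: "i \<in> {..<n}"
    have "s i k * X i k \<le> s i k * real_of_int (U (i, k))" if "k < K" for k
      using i that by (cases "s i k \<ge> 0") (auto simp: U_def intro: mult_left_mono mult_left_mono_neg)
    then show "(\<Sum>j<n. C i j * X i (g j)) \<le> (\<Sum>j<n. C i j * real_of_int (U (i, g j)))"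
      unfolding collect[of i "X i"] collect[of i "\<lambda>k. real_of_int (U (i, k))"]
      by (intro sum_mono) auto
  qed
  ultimately show ?thesis
    using that[of U] by (auto simp: U_def)
qed

lemma square_le_of_dist_le_1:
  fixes u x :: real
  assumes "\<bar>u - x\<bar> \<le> 1"
  shows "u\<^sup>2 \<le> 2 * x\<^sup>2 + 2"
proof -
  have "(u - x)\<^sup>2 \<le> 1"
    using assms by (simp add: abs_square_le_1)
  then show ?thesis
    using power2_add_le[of x "u - x"] by simp
qed

lemma int_mem_box:
  fixes u :: int
  assumes "\<bar>real_of_int u - x\<bar> \<le> 1" "x\<^sup>2 + 2 \<le> real m"
  shows "u \<in> {- int m..int m}"
proof -
  have "\<bar>x\<bar> \<le> x\<^sup>2 + 1"
    using sum_squares_bound[of "\<bar>x\<bar>" 1] by simp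
  then have "\<bar>real_of_int u\<bar> \<le> real m"
    using assms by linarith
  then show ?thesis by auto
qed

text \<open>With \<open>Y\<close> fixed the inner product is linear in \<open>X\<close>, and with
  \<open>U\<close> fixed it is linear in \<open>Y\<close>, so the factors are rounded one after the
  other. The assumptions on \<open>m\<close> only place the results in the box.\<close>

lemma block_rank1_round:
  assumes M: "block_rank1 n z c M"
    and z: "\<forall>i<n. z i < K" and c: "\<forall>k<K. c k < K"
    and m: "nsq n M + 2 \<le> real m" "n + 2 \<le> m"
  obtains U V where "U \<in> int_box m n K" "V \<in> int_box m n K"
    "ip n \<Xi> M \<le> ip n \<Xi> (lattice_matrix n z c U V)"
    "sumsq n K U \<le> 2 * nsq n M + 2 * n * K" "sumsq n K V \<le> 4 * n * K"
    "nsq n (lattice_matrix n z c U V) \<le> 4 * sumsq n K U"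
proof -
  obtain X Y where
    eq: "\<forall>i<n. \<forall>j<n. M i j = X i (z j) * Y j (c (z i)) / sqrt (card (Iblk n z (z j)))"
    and X: "(\<Sum>i<n. \<Sum>k<K. (X i k)\<^sup>2) = nsq n M"
    and Y: "\<forall>k l. (\<Sum>j\<in>Iblk n z k. (Y j l)\<^sup>2) \<le> card (Iblk n z k)"
    by (rule block_rank1_normalise[OF M z])
  have cz: "\<forall>i<n. c (z i) < K"
    using z c by auto
  let ?q = "\<lambda>j. sqrt (card (Iblk n z (z j)))"
  obtain U where U: "\<forall>x\<in>{..<n} \<times> {..<K}. \<bar>real_of_int (U x) - X (fst x) (snd x)\<bar> \<le> 1"
    and ipU: "(\<Sum>i<n. \<Sum>j<n. \<Xi> i j * Y j (c (z i)) / ?q j * X i (z j))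
       \<le> (\<Sum>i<n. \<Sum>j<n. \<Xi> i j * Y j (c (z i)) / ?q j * real_of_int (U (i, z j)))"
    and Uext: "U \<in> extensional ({..<n} \<times> {..<K})"
    by (rule round_by_coefficient_sign[OF z])
  \<comment> \<open>The coefficients already contain the rounded \<open>U\<close>, and the sums are
    exchanged so that the column node is the outer index.\<close>
  obtain V where V: "\<forall>x\<in>{..<n} \<times> {..<K}. \<bar>real_of_int (V x) - Y (fst x) (snd x)\<bar> \<le> 1"
    and ipV: "(\<Sum>j<n. \<Sum>i<n. \<Xi> i j * real_of_int (U (i, z j)) / ?q j * Y j (c (z i)))
       \<le> (\<Sum>j<n. \<Sum>i<n. \<Xi> i j * real_of_int (U (i, z j)) / ?q j * real_of_int (V (j, c (z i))))"
    and Vext: "V \<in> extensional ({..<n} \<times> {..<K})"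
    by (rule round_by_coefficient_sign[OF cz])
  have "ip n \<Xi> M = (\<Sum>i<n. \<Sum>j<n. \<Xi> i j * Y j (c (z i)) / ?q j * X i (z j))"
    unfolding ip_def using eq by (intro sum.cong) auto
  also note ipU
  also have "(\<Sum>i<n. \<Sum>j<n. \<Xi> i j * Y j (c (z i)) / ?q j * real_of_int (U (i, z j)))
      = (\<Sum>j<n. \<Sum>i<n. \<Xi> i j * real_of_int (U (i, z j)) / ?q j * Y j (c (z i)))"
    by (subst sum.swap) (simp add: mult_ac)
  also note ipV
  also have "(\<Sum>j<n. \<Sum>i<n. \<Xi> i j * real_of_int (U (i, z j)) / ?q j * real_of_int (V (j, c (z i))))
      = ip n \<Xi> (lattice_matrix n z c U V)"
    unfolding ip_def lattice_matrix_def by (subst sum.swap) (simp add: mult_ac)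
  finally have ip: "ip n \<Xi> M \<le> ip n \<Xi> (lattice_matrix n z c U V)" .

  have "sumsq n K U \<le> (\<Sum>i<n. \<Sum>k<K. 2 * (X i k)\<^sup>2 + 2)"
    unfolding sumsq_eq using U by (intro sum_mono square_le_of_dist_le_1) auto
  also have "\<dots> = 2 * nsq n M + 2 * n * K"
    by (simp add: sum.distrib sum_distrib_left[symmetric] X)
  finally have sU: "sumsq n K U \<le> 2 * nsq n M + 2 * n * K" .

  have V2: "(real_of_int (V (j, l)))\<^sup>2 \<le> 2 * (Y j l)\<^sup>2 + 2" if "j < n" "l < K" for j l
    using that V by (intro square_le_of_dist_le_1) auto
  \<comment> \<open>Half of the 4 comes from doubling the norm of \<open>Y\<close>, half from the
    additive 2 per entry. The cardinality later cancels the denominator of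
    \<open>lattice_matrix\<close>.\<close>
  have Vcol: "(\<Sum>j\<in>Iblk n z k. (real_of_int (V (j, l)))\<^sup>2) \<le> 4 * card (Iblk n z k)" if "l < K" for k l
  proof -
    have "(\<Sum>j\<in>Iblk n z k. (real_of_int (V (j, l)))\<^sup>2) \<le> (\<Sum>j\<in>Iblk n z k. 2 * (Y j l)\<^sup>2 + 2)"
      using that by (intro sum_mono V2) (auto simp: Iblk_def)
    also have "\<dots> = 2 * (\<Sum>j\<in>Iblk n z k. (Y j l)\<^sup>2) + 2 * card (Iblk n z k)"
      by (simp add: sum.distrib sum_distrib_left)
    also have "\<dots> \<le> 4 * card (Iblk n z k)"
      using Y[rule_format, where k = k and l = l] by linarith
    finally show ?thesis by simp
  qed
  have "sumsq n K V = (\<Sum>l<K. \<Sum>k<K. \<Sum>j\<in>Iblk n z k. (real_of_int (V (j, l)))\<^sup>2)"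
    unfolding sumsq_eq Iblk_def sum_fibres[OF z] by (rule sum.swap)
  also have "\<dots> \<le> (\<Sum>l<K. \<Sum>k<K. \<Sum>j\<in>Iblk n z k. 4)"
    by (intro sum_mono order_trans[OF Vcol]) auto
  also have "\<dots> = 4 * n * K"
    unfolding Iblk_def sum_fibres[OF z] by simp
  finally have sV: "sumsq n K V \<le> 4 * n * K" .

  have "(\<Sum>j<n. (lattice_matrix n z c U V i j)\<^sup>2) \<le> (\<Sum>k<K. 4 * (real_of_int (U (i, k)))\<^sup>2)"
    if "i < n" for i
  proof -
    let ?l = "c (z i)"
    have "(\<Sum>j<n. (lattice_matrix n z c U V i j)\<^sup>2)
        = (\<Sum>k<K. \<Sum>j\<in>Iblk n z k. (lattice_matrix n z c U V i j)\<^sup>2)"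
      unfolding Iblk_def by (rule sum_fibres[OF z, symmetric])
    also have "\<dots> = (\<Sum>k<K. (real_of_int (U (i, k)))\<^sup>2 *
        ((\<Sum>j\<in>Iblk n z k. (real_of_int (V (j, ?l)))\<^sup>2) / card (Iblk n z k)))"
      by (rule sum.cong)
         (auto simp: lattice_matrix_def power_divide power_mult_distrib sum_distrib_left
                     sum_divide_distrib Iblk_def intro!: sum.cong)
    also have "\<dots> \<le> (\<Sum>k<K. (real_of_int (U (i, k)))\<^sup>2 * 4)"
      using that cz Vcol by (intro sum_mono mult_left_mono divide_le_eq[THEN iffD2]) (auto simp: divide_le_eq)
    finally show ?thesis by (simp add: mult.commute)
  qed
  then have nlat: "nsq n (lattice_matrix n z c U V) \<le> 4 * sumsq n K U"
    unfolding nsq_def sumsq_eq sum_distrib_left by (intro sum_mono) auto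

  have "(X i k)\<^sup>2 \<le> nsq n M" if "i < n" "k < K" for i k
  proof -
    have "(X i k)\<^sup>2 \<le> (\<Sum>k<K. (X i k)\<^sup>2)"
      using that by (intro member_le_sum) auto
    also have "\<dots> \<le> (\<Sum>i<n. \<Sum>k<K. (X i k)\<^sup>2)"
      using that by (intro member_le_sum[of i "{..<n}" "\<lambda>i. \<Sum>k<K. (X i k)\<^sup>2"]) (auto intro: sum_nonneg)
    finally show ?thesis by (simp add: X)
  qed
  then have "(X i k)\<^sup>2 + 2 \<le> real m" if "i < n" "k < K" for i k
    using m(1) that by force
  then have Ubox: "U \<in> int_box m n K"
    using U Uext unfolding int_box_def PiE_def
    by (auto simp del: atLeastAtMost_iff intro!: int_mem_box)
  have "(Y j l)\<^sup>2 + 2 \<le> real m" if "j < n" for j l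
  proof -
    have "(Y j l)\<^sup>2 \<le> (\<Sum>j\<in>Iblk n z (z j). (Y j l)\<^sup>2)"
      using that by (intro member_le_sum) (auto simp: Iblk_def)
    also have "\<dots> \<le> card (Iblk n z (z j))" using Y by blast
    also have "\<dots> \<le> n"
      using card_mono[of "{..<n}" "Iblk n z (z j)"] by (auto simp: Iblk_def)
    finally show ?thesis using m(2) by linarith
  qed
  then have Vbox: "V \<in> int_box m n K"
    using V Vext unfolding int_box_def PiE_def
    by (auto simp del: atLeastAtMost_iff intro!: int_mem_box)
  show ?thesis
    using that Ubox Vbox ip sU sV nlat by blast
qed

subsection \<open>The exponential mixture\<close>

text \<open>Two geometric series of ratio \<open>exp (- c)\<close>, one for each sign: a bound for
  discrete Gaussian sums that is uniform in the cut-off.\<close>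

definition gauss_const :: "real \<Rightarrow> real" where
  "gauss_const c = 2 / (1 - exp (- c))"

lemma gauss_const_gt_1: "c > 0 \<Longrightarrow> gauss_const c > 1"
  by (simp add: gauss_const_def less_divide_eq) (smt (verit) exp_gt_zero)

text \<open>An integer is at most its square, so a geometric series dominates each half. Zero is
  counted twice, which only enlarges the bound.\<close>

lemma sum_exp_square_le:
  assumes "c > 0"
  shows "(\<Sum>u\<in>{- int m..int m}. exp (- c * (real_of_int u)\<^sup>2)) \<le> gauss_const c"
proof -
  let ?f = "\<lambda>u::int. exp (- c * (real_of_int u)\<^sup>2)"
  have r: "0 < exp (- c)" "exp (- c) < 1"
    using assms by auto
  have "?f (int k) \<le> exp (- c) ^ k" for k
  proof -
    have "real k \<le> (real k)\<^sup>2"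
      by (cases k) (auto simp: power2_eq_square)
    then show ?thesis
      using assms by (simp add: exp_of_nat_mult[symmetric] mult.commute mult_left_mono)
  qed
  then have "(\<Sum>k\<le>m. ?f (int k)) \<le> (\<Sum>k\<le>m. exp (- c) ^ k)"
    by (intro sum_mono)
  also have "\<dots> \<le> 1 / (1 - exp (- c))"
    using r by (auto simp: sum_gp0 intro!: divide_right_mono)
  finally have half: "(\<Sum>k\<le>m. ?f (int k)) \<le> 1 / (1 - exp (- c))" .
  have "{- int m..int m} \<subseteq> int ` {..m} \<union> (\<lambda>k. - int k) ` {..m}"
  proof
    fix u assume "u \<in> {- int m..int m}"
    then have "u = int (nat u) \<and> nat u \<le> m \<or> u = - int (nat (- u)) \<and> nat (- u) \<le> m"
      by auto
    then show "u \<in> int ` {..m} \<union> (\<lambda>k. - int k) ` {..m}"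
      by blast
  qed
  then have "(\<Sum>u\<in>{- int m..int m}. ?f u) \<le> (\<Sum>u\<in>int ` {..m} \<union> (\<lambda>k. - int k) ` {..m}. ?f u)"
    by (intro sum_mono2) auto
  also have "\<dots> \<le> (\<Sum>u\<in>int ` {..m}. ?f u) + (\<Sum>u\<in>(\<lambda>k. - int k) ` {..m}. ?f u)"
    by (subst sum_Un) (auto intro: sum_nonneg)
  also have "\<dots> = 2 * (\<Sum>k\<le>m. ?f (int k))"
    by (simp add: sum.reindex inj_on_def)
  also have "\<dots> \<le> gauss_const c"
    using half by (simp add: gauss_const_def)
  finally show ?thesis .
qed

lemma finite_int_box: "finite (int_box m n K)"
  unfolding int_box_def by (intro finite_PiE) auto

text \<open>The sum factorises over coordinates. The logarithm of the bound is linear in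
  \<open>n * K\<close>, so it can be charged to the first penalty term.\<close>

lemma sum_exp_sumsq_le:
  assumes "c > 0"
  shows "(\<Sum>U\<in>int_box m n K. exp (- c * sumsq n K U)) \<le> gauss_const c ^ (n * K)"
proof -
  have "(\<Sum>U\<in>int_box m n K. exp (- c * sumsq n K U))
      = (\<Sum>U\<in>int_box m n K. \<Prod>x\<in>{..<n} \<times> {..<K}. exp (- c * (real_of_int (U x))\<^sup>2))"
    by (simp add: sumsq_def sum_distrib_left exp_sum flip: sum_negf)
  also have "\<dots> = (\<Prod>x\<in>{..<n} \<times> {..<K}. \<Sum>u\<in>{- int m..int m}. exp (- c * (real_of_int u)\<^sup>2))"
    unfolding int_box_def by (rule prod_sum_PiE[symmetric]) auto
  also have "\<dots> \<le> (\<Prod>x\<in>{..<n} \<times> {..<K}. gauss_const c)"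
    using sum_exp_square_le[OF assms, of m] by (intro prod_mono) (auto intro: sum_nonneg)
  finally show ?thesis
    by (simp add: card_cartesian_product)
qed

text \<open>
  A configuration \<open>(K, z, c, (U1, V1), (U2, V2))\<close> has no component for \<open>L\<close>: every map into
  \<open>{..<L}\<close> is a map into \<open>{..<K}\<close>. The box bound \<open>m\<close> only keeps sums finite; no estimate depends on it.
\<close>

type_synonym config =
  "nat \<times> (nat \<Rightarrow> nat) \<times> (nat \<Rightarrow> nat) \<times>
   ((nat \<times> nat \<Rightarrow> int) \<times> (nat \<times> nat \<Rightarrow> int)) \<times> (nat \<times> nat \<Rightarrow> int) \<times> (nat \<times> nat \<Rightarrow> int)"

definition configs :: "nat \<Rightarrow> nat \<Rightarrow> config set" where
  "configs m n = (SIGMA K:{1..n}. ({..<n} \<rightarrow>\<^sub>E {..<K}) \<times> ({..<K} \<rightarrow>\<^sub>E {..<K}) \<times>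
     (int_box m n K \<times> int_box m n K) \<times> (int_box m n K \<times> int_box m n K))"

text \<open>The denominator accounts for the \<open>n\<close> values of \<open>K\<close>, the node
  clusterings, the maps between labels, and one Gaussian normaliser for each of the four integer
  arrays.\<close>

definition weight :: "real \<Rightarrow> nat \<Rightarrow> config \<Rightarrow> real" where
  "weight c n = (\<lambda>(K, _, _, (U1, V1), (U2, V2)).
     exp (- c * sumsq n K U1) * exp (- c * sumsq n K V1) *
     (exp (- c * sumsq n K U2) * exp (- c * sumsq n K V2)) /
     (real n * real K ^ n * real K ^ K * gauss_const c ^ (4 * (n * K))))"

lemma finite_configs: "finite (configs m n)"
  unfolding configs_def by (intro finite_SigmaI finite_cartesian_product finite_PiE finite_int_box) auto

lemma weight_pos: "c > 0 \<Longrightarrow> s \<in> configs m n \<Longrightarrow> weight c n s > 0"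
  using gauss_const_gt_1[of c] by (auto simp: weight_def configs_def)

lemma sum_weight_le_1:
  assumes c: "c > 0"
  shows "sum (weight c n) (configs m n) \<le> 1"
proof -
  have "sum (weight c n) (configs m n) = (\<Sum>K\<in>{1..n}.
      \<Sum>s\<in>({..<n} \<rightarrow>\<^sub>E {..<K}) \<times> ({..<K} \<rightarrow>\<^sub>E {..<K}) \<times>
        (int_box m n K \<times> int_box m n K) \<times> (int_box m n K \<times> int_box m n K). weight c n (K, s))"
    unfolding configs_def
    by (subst sum.Sigma) (auto intro!: finite_PiE finite_int_box)
  also have "\<dots> \<le> (\<Sum>K\<in>{1..n}. 1 / n)"
  proof (rule sum_mono)
    fix K assume K: "K \<in> {1..n}"
    define E where "E = (\<Sum>U\<in>int_box m n K. exp (- c * sumsq n K U))"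
    define D where "D = real n * real K ^ n * real K ^ K * gauss_const c ^ (4 * (n * K))"
    have D: "D > 0"
      using K gauss_const_gt_1[OF c] by (auto simp: D_def)
    have E: "0 \<le> E" "E \<le> gauss_const c ^ (n * K)"
      unfolding E_def using sum_exp_sumsq_le[OF c] by (auto intro: sum_nonneg)
    have inner: "(\<Sum>t\<in>(int_box m n K \<times> int_box m n K) \<times> (int_box m n K \<times> int_box m n K).
        weight c n (K, z, y, t)) = (E * E) * (E * E) / D" for z y
      unfolding E_def weight_def D_def sum_product sum.cartesian_product
      by (simp add: case_prod_unfold sum_divide_distrib mult.assoc)
    have "(\<Sum>s\<in>({..<n} \<rightarrow>\<^sub>E {..<K}) \<times> ({..<K} \<rightarrow>\<^sub>E {..<K}) \<times>
        (int_box m n K \<times> int_box m n K) \<times> (int_box m n K \<times> int_box m n K). weight c n (K, s))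
      = (\<Sum>z\<in>{..<n} \<rightarrow>\<^sub>E {..<K}. \<Sum>y\<in>{..<K} \<rightarrow>\<^sub>E {..<K}.
          \<Sum>t\<in>(int_box m n K \<times> int_box m n K) \<times> (int_box m n K \<times> int_box m n K).
          weight c n (K, z, y, t))"
      by (simp add: sum.cartesian_product case_prod_unfold)
    also have "\<dots> = (\<Sum>z\<in>{..<n} \<rightarrow>\<^sub>E {..<K}. \<Sum>y\<in>{..<K} \<rightarrow>\<^sub>E {..<K}. (E * E) * (E * E) / D)"
      by (simp only: inner)
    also have "\<dots> = real K ^ n * real K ^ K * E ^ 4 / D"
      by (simp add: card_PiE eval_nat_numeral)
    also have "\<dots> \<le> real K ^ n * real K ^ K * (gauss_const c ^ (n * K)) ^ 4 / D"
      using E D by (intro divide_right_mono mult_left_mono power_mono) auto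
    also have "\<dots> = 1 / n"
      using K gauss_const_gt_1[OF c]
      by (simp add: D_def power_mult[symmetric] mult.commute)
    finally show "(\<Sum>s\<in>({..<n} \<rightarrow>\<^sub>E {..<K}) \<times> ({..<K} \<rightarrow>\<^sub>E {..<K}) \<times>
        (int_box m n K \<times> int_box m n K) \<times> (int_box m n K \<times> int_box m n K). weight c n (K, s)) \<le> 1 / n" .
  qed
  also have "\<dots> \<le> 1" by simp
  finally show ?thesis .
qed

lemma ln_weight:
  assumes c: "c > 0" and s: "(K, z, y, (U1, V1), (U2, V2)) \<in> configs m n"
  shows "ln (weight c n (K, z, y, (U1, V1), (U2, V2))) =
     - c * (sumsq n K U1 + sumsq n K V1 + sumsq n K U2 + sumsq n K V2)
     - (ln n + n * ln K + K * ln K + 4 * (n * K) * ln (gauss_const c))"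
proof -
  have "n > 0" "K > 0" "gauss_const c > 0"
    using s gauss_const_gt_1[OF c] by (auto simp: configs_def)
  then show ?thesis
    by (simp add: weight_def ln_div ln_mult ln_realpow algebra_simps)
qed

text \<open>\<open>Q\<close> depends on the clustering but not on the sampled graph, so each
  direction is deterministic and \<open>noise_mgf\<close> applies to it.\<close>

definition direction ::
  "nat \<Rightarrow> (nat \<Rightarrow> nat \<Rightarrow> real) \<Rightarrow> ((nat \<Rightarrow> nat) \<Rightarrow> (nat \<Rightarrow> nat) \<Rightarrow> nat \<Rightarrow> nat \<Rightarrow> real)
     \<Rightarrow> config \<Rightarrow> nat \<Rightarrow> nat \<Rightarrow> real" where
  "direction n P Q = (\<lambda>(K, z, c, (U1, V1), (U2, V2)) i j. (Q z c i j - P i j)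
     + lattice_matrix n z c U1 V1 i j + lattice_matrix n z c U2 V2 i j)"

text \<open>The subtracted term is the exponent in \<open>noise_mgf\<close>, so each exponential has
  expectation at most 1.\<close>

definition mixture where
  "mixture \<mu> w S G n A P = (\<Sum>s\<in>S. w s * exp (\<mu> * ip n (\<lambda>i j. A i j - P i j) (G s) - \<mu>\<^sup>2 * nsq n (G s) / 4))"

lemma expectation_mixture_le_1:
  assumes "\<forall>i<n. \<forall>j<n. P i j = P j i" "\<forall>i<n. \<forall>j<n. 0 \<le> P i j \<and> P i j \<le> 1"
    and w: "\<forall>s\<in>S. 0 \<le> w s" "sum w S \<le> 1"
  shows "measure_pmf.expectation (edge_pmf n P) (\<lambda>X. mixture \<mu> w S G n (adj X) P) \<le> 1"
proof -
  have int: "integrable (edge_pmf n P) f" for f :: "_ \<Rightarrow> real"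
    by (rule integrable_measure_pmf_finite[OF finite_set_edge_pmf])
  have "measure_pmf.expectation (edge_pmf n P) (\<lambda>X. mixture \<mu> w S G n (adj X) P)
      = (\<Sum>s\<in>S. w s * (measure_pmf.expectation (edge_pmf n P)
          (\<lambda>X. exp (\<mu> * ip n (\<lambda>i j. adj X i j - P i j) (G s))) / exp (\<mu>\<^sup>2 * nsq n (G s) / 4)))"
    unfolding mixture_def exp_diff
    by (subst Bochner_Integration.integral_sum) (auto intro: int)
  also have "\<dots> \<le> (\<Sum>s\<in>S. w s * 1)"
    using w noise_mgf[OF assms(1,2)] by (intro sum_mono mult_left_mono) (auto simp: divide_le_eq)
  also have "\<dots> \<le> 1" using w by simp
  finally show ?thesis .
qed

text \<open>All summands are positive, so each is at most the mixture. The bound holds for every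
  \<open>s\<close> at once and replaces a union bound, with \<open>- ln (w s)\<close> as the price
  of the configuration.\<close>

lemma le_ln_mixture:
  assumes "finite S" "\<forall>s\<in>S. 0 < w s" "s \<in> S"
  shows "\<mu> * ip n (\<lambda>i j. A i j - P i j) (G s) \<le> \<mu>\<^sup>2 * nsq n (G s) / 4 - ln (w s) + ln (mixture \<mu> w S G n A P)"
    and "mixture \<mu> w S G n A P > 0"
proof -
  let ?t = "\<lambda>s. w s * exp (\<mu> * ip n (\<lambda>i j. A i j - P i j) (G s) - \<mu>\<^sup>2 * nsq n (G s) / 4)"
  have le: "?t s \<le> mixture \<mu> w S G n A P"
    unfolding mixture_def using assms by (intro member_le_sum) (auto intro: less_imp_le)
  moreover have pos: "?t s > 0"
    using assms by auto
  ultimately show "mixture \<mu> w S G n A P > 0" by linarith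
  have "ln (?t s) \<le> ln (mixture \<mu> w S G n A P)"
    using le pos by (intro ln_mono) auto
  moreover have "ln (?t s) = ln (w s) + (\<mu> * ip n (\<lambda>i j. A i j - P i j) (G s) - \<mu>\<^sup>2 * nsq n (G s) / 4)"
    using assms by (subst ln_mult_pos) auto
  ultimately show "\<mu> * ip n (\<lambda>i j. A i j - P i j) (G s) \<le> \<mu>\<^sup>2 * nsq n (G s) / 4 - ln (w s) + ln (mixture \<mu> w S G n A P)"
    by linarith
qed

subsection \<open>The risk bound\<close>

text \<open>The slack 1 lets an element close to the infimum serve, so attainment is not at issue.
  One choice covers all clusterings.\<close>

lemma near_best_block_rank1_exists:
  "\<exists>Q. \<forall>z c. block_rank1 n z c (Q z c) \<and>
     (\<forall>M. block_rank1 n z c M \<longrightarrow> frob2 n (Q z c) P \<le> frob2 n M P + 1)"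
proof -
  have "\<exists>Q. block_rank1 n z c Q \<and> (\<forall>M. block_rank1 n z c M \<longrightarrow> frob2 n Q P \<le> frob2 n M P + 1)" for z c
  proof -
    let ?S = "(\<lambda>M. frob2 n M P) ` {M. block_rank1 n z c M}"
    have "block_rank1 n z c (\<lambda>_ _. 0)"
      unfolding block_rank1_def by (intro exI[of _ "\<lambda>_ _. 0"]) simp
    then have ne: "?S \<noteq> {}" by blast
    have bdd: "bdd_below ?S"
      by (intro bdd_belowI[of _ 0]) (auto simp: frob2_eq_nsq nsq_nonneg)
    have "Inf ?S < Inf ?S + 1" by simp
    then obtain x where "x \<in> ?S" "x < Inf ?S + 1"
      using cInf_lessD[OF ne] by blast
    then obtain Q where "block_rank1 n z c Q" "frob2 n Q P < Inf ?S + 1"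
      by blast
    moreover have "Inf ?S \<le> frob2 n M P" if "block_rank1 n z c M" for M
      using that by (intro cInf_lower bdd) auto
    ultimately show ?thesis
      by (intro exI[of _ Q]) force
  qed
  then show ?thesis by metis
qed

lemma pen_nonneg:
  assumes "\<Psi>1 \<ge> 0" "\<Psi>2 \<ge> 0" "\<Psi>3 \<ge> 0" "1 \<le> K" "1 \<le> n"
  shows "0 \<le> pen \<Psi>1 \<Psi>2 \<Psi>3 n K L"
  using assms unfolding pen_def by (intro add_nonneg_nonneg mult_nonneg_nonneg) auto

text \<open>With \<open>\<mu> = 1/200\<close> and Gaussian parameter
  \<open>\<mu>\<^sup>2 = 1/40000\<close>, the term \<open>2 * g\<close> costs 400 times the negative
  log-weight. This produces \<open>1600 * ln \<kappa>\<close> per \<open>n * K\<close> and 400 per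
  \<open>n * ln K\<close>, which the penalty constants match.\<close>

lemma pathwise_risk_bound:
  fixes A P
  defines "\<kappa> \<equiv> gauss_const (1/40000)"
  defines "\<Psi> \<equiv> 802 + 1600 * ln \<kappa>"
  assumes n: "n \<ge> 2"
    and min: "is_minimizer \<Psi> 1 400 n A z c K L"
    and R: "is_blockwise_rank1 n A z c K L R"
    and P: "nbm_repr n K' L' P z' c' B H"
    and Q: "\<forall>z c. block_rank1 n z c (Q z c) \<and>
     (\<forall>M. block_rank1 n z c M \<longrightarrow> frob2 n (Q z c) P \<le> frob2 n M P + 1)"
    and m: "4 * frob2 n R P + 4 \<le> real m" "n + 2 \<le> m"
  shows "frob2 n R P \<le> 800 * (pen \<Psi> 1 400 n K' L' +
           ln (mixture (1/200) (weight (1/40000) n) (configs m n) (direction n P Q) n A P))"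
    and "mixture (1/200) (weight (1/40000) n) (configs m n) (direction n P Q) n A P > 0"
proof -
  let ?\<Xi> = "\<lambda>i j. A i j - P i j"
  let ?W = "mixture (1/200) (weight (1/40000) n) (configs m n) (direction n P Q) n A P"
  define f where "f = frob2 n R P"
  define T where "T = real n * real K"
  define y where "y = restrict z {..<n}"
  define d where "d = restrict c {..<K}"
  have adm: "admissible n z c K L"
    using min by (simp add: is_minimizer_def)
  then have K: "1 \<le> K" "K \<le> n" and zK: "\<forall>i<n. z i < K" and cK: "\<forall>k<K. c k < K"
    by (auto simp: admissible_def)
  have yK: "\<forall>i<n. y i < K" and dK: "\<forall>k<K. d k < K"
    using zK cK by (auto simp: y_def d_def)
  have yd: "y \<in> {..<n} \<rightarrow>\<^sub>E {..<K}" "d \<in> {..<K} \<rightarrow>\<^sub>E {..<K}"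
    using zK cK by (auto simp: y_def d_def)
  have R1: "block_rank1 n y d R"
    unfolding y_def d_def by (rule is_blockwise_rank1_imp_block_rank1[OF adm R])
  \<comment> \<open>\<open>R\<close> is blockwise rank one for the same clustering, hence a
    competitor for \<open>Q y d\<close>.\<close>
  have Q1: "block_rank1 n y d (Q y d)" and D0: "frob2 n (Q y d) P \<le> f + 1"
    using Q R1 by (auto simp: f_def)
  obtain M1 M2 where M1: "block_rank1 n y d M1" and M2: "block_rank1 n y d M2"
    and split: "\<forall>i<n. \<forall>j<n. R i j - Q y d i j = M1 i j + M2 i j"
    and pyth: "nsq n M1 + nsq n M2 = nsq n (\<lambda>i j. R i j - Q y d i j)"
    by (rule block_rank1_diff_split[OF R1 Q1])
  have "nsq n (\<lambda>i j. R i j - Q y d i j)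
      \<le> (\<Sum>i<n. \<Sum>j<n. 2 * (R i j - P i j)\<^sup>2 + 2 * (Q y d i j - P i j)\<^sup>2)"
    unfolding nsq_def
  proof (intro sum_mono)
    fix i j
    show "(R i j - Q y d i j)\<^sup>2 \<le> 2 * (R i j - P i j)\<^sup>2 + 2 * (Q y d i j - P i j)\<^sup>2"
      using power2_add_le[of "R i j - P i j" "P i j - Q y d i j"] by (simp add: power2_commute)
  qed
  also have "\<dots> = 2 * f + 2 * frob2 n (Q y d) P"
    by (simp add: f_def frob2_def sum.distrib sum_distrib_left)
  finally have F: "nsq n M1 + nsq n M2 \<le> 4 * f + 2"
    using D0 pyth by linarith
  have m12: "nsq n M1 + 2 \<le> real m" "nsq n M2 + 2 \<le> real m"
    using F m(1) nsq_nonneg[of n M1] nsq_nonneg[of n M2] by (auto simp: f_def)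
  obtain U1 V1 where 1: "U1 \<in> int_box m n K" "V1 \<in> int_box m n K"
    "ip n ?\<Xi> M1 \<le> ip n ?\<Xi> (lattice_matrix n y d U1 V1)"
    "sumsq n K U1 \<le> 2 * nsq n M1 + 2 * n * K" "sumsq n K V1 \<le> 4 * n * K"
    "nsq n (lattice_matrix n y d U1 V1) \<le> 4 * sumsq n K U1"
    by (rule block_rank1_round[OF M1 yK dK m12(1) m(2)])
  obtain U2 V2 where 2: "U2 \<in> int_box m n K" "V2 \<in> int_box m n K"
    "ip n ?\<Xi> M2 \<le> ip n ?\<Xi> (lattice_matrix n y d U2 V2)"
    "sumsq n K U2 \<le> 2 * nsq n M2 + 2 * n * K" "sumsq n K V2 \<le> 4 * n * K"
    "nsq n (lattice_matrix n y d U2 V2) \<le> 4 * sumsq n K U2"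
    by (rule block_rank1_round[OF M2 yK dK m12(2) m(2)])
  define s where "s = (K, y, d, (U1, V1), (U2, V2))"
  have s: "s \<in> configs m n"
    using K yd 1 2 by (auto simp: s_def configs_def)
  define g where "g = ip n ?\<Xi> (direction n P Q s)"
  define N where "N = nsq n (direction n P Q s)"
  have wpos: "\<forall>s\<in>configs m n. 0 < weight (1/40000) n s"
    by (auto intro: weight_pos)
  have dev: "1/200 * g \<le> (1/200)\<^sup>2 * N / 4 - ln (weight (1/40000) n s) + ln ?W"
    unfolding g_def N_def by (rule le_ln_mixture(1)[OF finite_configs wpos s])
  show "?W > 0"
    by (rule le_ln_mixture(2)[OF finite_configs wpos s])
  have "ip n ?\<Xi> (\<lambda>i j. R i j - P i j)
      = ip n ?\<Xi> (\<lambda>i j. Q y d i j - P i j) + ip n ?\<Xi> M1 + ip n ?\<Xi> M2"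
  proof -
    have "ip n ?\<Xi> (\<lambda>i j. R i j - P i j) = ip n ?\<Xi> (\<lambda>i j. (Q y d i j - P i j) + M1 i j + M2 i j)"
      unfolding ip_def
    proof (intro sum.cong refl)
      fix i j assume "i \<in> {..<n}" "j \<in> {..<n}"
      then have "R i j = Q y d i j + M1 i j + M2 i j"
        using split by (simp add: algebra_simps)
      then show "(A i j - P i j) * (R i j - P i j) = (A i j - P i j) * (Q y d i j - P i j + M1 i j + M2 i j)"
        by simp
    qed
    then show ?thesis
      by (simp add: ip_def distrib_left sum.distrib)
  qed
  also have "\<dots> \<le> g"
    using 1(3) 2(3) by (simp add: g_def s_def direction_def ip_def distrib_left sum.distrib)
  finally have basic: "f \<le> 2 * g + pen \<Psi> 1 400 n K' L' - pen \<Psi> 1 400 n K L"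
    using penalised_least_squares[OF min R P] unfolding f_def by linarith
  have N: "N \<le> 3 * (frob2 n (Q y d) P + nsq n (lattice_matrix n y d U1 V1) + nsq n (lattice_matrix n y d U2 V2))"
    using nsq_add3[of n "\<lambda>i j. Q y d i j - P i j" "lattice_matrix n y d U1 V1" "lattice_matrix n y d U2 V2"]
    by (simp add: N_def s_def direction_def frob2_eq_nsq)
  have lnw: "- ln (weight (1/40000) n s) = 1/40000 * (sumsq n K U1 + sumsq n K V1 + sumsq n K U2 + sumsq n K V2)
     + (ln n + n * ln K + K * ln K + 4 * (T * ln \<kappa>))"
    using ln_weight[OF _ s[unfolded s_def], of "1/40000"]
    by (simp add: s_def \<kappa>_def T_def algebra_simps)
  have lnn: "ln n \<le> real n"
    using ln_bound[of "real n"] n by simp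
  have T: "real n \<le> T" "1 \<le> T"
    using K n mult_mono[of 1 "real n" 1 "real K"] by (auto simp: T_def mult_le_cancel_left1)
  have "ln (real K) \<le> real n"
    using ln_bound[of "real K"] K by linarith
  then have "real K * ln (real K) \<le> real K * real n"
    by (intro mult_left_mono) auto
  then have KlnK: "K * ln K \<le> T"
    by (simp add: T_def mult.commute)
  have sums: "sumsq n K U1 \<le> 2 * nsq n M1 + 2 * T" "sumsq n K V1 \<le> 4 * T"
    "sumsq n K U2 \<le> 2 * nsq n M2 + 2 * T" "sumsq n K V2 \<le> 4 * T"
    using 1(4,5) 2(4,5) by (simp_all add: T_def mult.assoc)
  \<comment> \<open>The 99 is \<open>3 * (1 + 4 * 2 * 4)\<close>: three summands in
    \<open>nsq_add3\<close>, 4 from the lattice bound, 2 from rounding and 4 from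
    \<open>F\<close>.\<close>
  have N': "N \<le> 99 * f + 51 + 48 * T"
    using N 1(6) 2(6) sums(1,3) D0 F by argo
  have "sumsq n K U1 + sumsq n K V1 + sumsq n K U2 + sumsq n K V2 \<le> 8 * f + 4 + 12 * T"
    using sums F by argo
  then have lnw': "- ln (weight (1/40000) n s)
      \<le> (8 * f + 4 + 12 * T) / 40000 + 2 * T + n * ln K + 4 * (T * ln \<kappa>)"
    using lnw lnn T KlnK by argo
  have dev': "g \<le> N / 800 - 200 * ln (weight (1/40000) n s) + 200 * ln ?W"
    using dev by (simp add: power2_eq_square)
  have "pen \<Psi> 1 400 n K L = 802 * T + 1600 * (T * ln \<kappa>) + (real K)\<^sup>2 * ln n + 400 * (n * ln K)"
    by (simp add: pen_def \<Psi>_def T_def algebra_simps)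
  moreover have "0 \<le> (real K)\<^sup>2 * ln n"
    using n by simp
  moreover have "0 \<le> f"
    by (simp add: f_def frob2_eq_nsq nsq_nonneg)
  \<comment> \<open>On the right \<open>f\<close> has coefficient \<open>99/400 + 8/100\<close>,
    below 1/2, and is absorbed. The multiples of \<open>T\<close> and the constants, bounded using
    \<open>1 \<le> T\<close>, stay below \<open>802 * T\<close>.\<close>
  ultimately have "f \<le> 2 * pen \<Psi> 1 400 n K' L' + 800 * ln ?W"
    using basic dev' N' lnw' T(2) by argo
  moreover have "0 \<le> pen \<Psi> 1 400 n K' L'"
    using gauss_const_gt_1[of "1/40000"] P n
    by (intro pen_nonneg) (auto simp: \<Psi>_def \<kappa>_def nbm_repr_def)
  ultimately show "frob2 n R P \<le> 800 * (pen \<Psi> 1 400 n K' L' + ln ?W)"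
    unfolding f_def by argo
qed

section \<open>From the pathwise bound to the tail and expectation bounds\<close>

theorem theorem2:
  shows "\<exists>\<Psi>1 \<Psi>2 \<Psi>3 Ct :: real. \<Psi>1 > 0 \<and> \<Psi>2 > 0 \<and> \<Psi>3 > 0 \<and> Ct > 0 \<and>
    (\<forall>(n :: nat) (Pstar :: nat \<Rightarrow> nat \<Rightarrow> real) (Ks :: nat) (Ls :: nat)
        (zs :: nat \<Rightarrow> nat) (cs :: nat \<Rightarrow> nat) (B :: nat \<Rightarrow> nat \<Rightarrow> real) (H :: nat \<Rightarrow> nat \<Rightarrow> real)
        (lam0 :: real)
        (sel :: (nat \<Rightarrow> nat \<Rightarrow> real) \<Rightarrow> (nat \<Rightarrow> nat) \<times> (nat \<Rightarrow> nat) \<times> nat \<times> nat)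
        (Phat :: (nat \<Rightarrow> nat \<Rightarrow> real) \<Rightarrow> (nat \<Rightarrow> nat \<Rightarrow> real)).
      n \<ge> 2 \<and>
      (\<forall>i<n. \<forall>j<n. Pstar i j = Pstar j i) \<and>
      nbm_repr n Ks Ls Pstar zs cs B H \<and>
      lam0 > 0 \<and> smallest_sv_ge Ks B lam0 \<and>
      lin_indep_h n Ks Ls zs H \<and>
      (\<forall>A. case sel A of (z, c, K, L) \<Rightarrow>
              is_minimizer \<Psi>1 \<Psi>2 \<Psi>3 n A z c K L \<and> is_blockwise_rank1 n A z c K L (Phat A))
      \<longrightarrow>
      (\<forall>t > 0. measure_pmf.prob (edge_pmf n Pstar)
                 {X. frob2 n (Phat (adj X)) Pstar \<le> Ct * (pen \<Psi>1 \<Psi>2 \<Psi>3 n Ks Ls + t)}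
               \<ge> 1 - 3 * exp (- t)) \<and>
      measure_pmf.expectation (edge_pmf n Pstar) (\<lambda>X. frob2 n (Phat (adj X)) Pstar)
        \<le> Ct * (pen \<Psi>1 \<Psi>2 \<Psi>3 n Ks Ls + 3))"
proof -
  let ?\<Psi> = "802 + 1600 * ln (gauss_const (1/40000))"
  have main: "(\<forall>t > 0. measure_pmf.prob (edge_pmf n P)
                 {X. frob2 n (R (adj X)) P \<le> 800 * (pen ?\<Psi> 1 400 n Ks Ls + t)}
               \<ge> 1 - 3 * exp (- t)) \<and>
      measure_pmf.expectation (edge_pmf n P) (\<lambda>X. frob2 n (R (adj X)) P)
        \<le> 800 * (pen ?\<Psi> 1 400 n Ks Ls + 3)"
    if n: "n \<ge> 2" and sym: "\<forall>i<n. \<forall>j<n. P i j = P j i"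
      and repr: "nbm_repr n Ks Ls P zs cs B H"
      and sel: "\<forall>A. case sel A of (z, c, K, L) \<Rightarrow>
              is_minimizer ?\<Psi> 1 400 n A z c K L \<and> is_blockwise_rank1 n A z c K L (R A)"
    for n P Ks Ls zs cs B H sel R
  proof -
    let ?M = "edge_pmf n P" and ?f = "\<lambda>X. frob2 n (R (adj X)) P" and ?pen = "pen ?\<Psi> 1 400 n Ks Ls"
    obtain Q where Q: "\<forall>z c. block_rank1 n z c (Q z c) \<and>
        (\<forall>N. block_rank1 n z c N \<longrightarrow> frob2 n (Q z c) P \<le> frob2 n N P + 1)"
      using near_best_block_rank1_exists by blast
    \<comment> \<open>A bound on the loss over the finite support gives one box size
      \<open>m\<close>, and hence one mixture, for all outcomes.\<close>
    have "bdd_above (?f ` set_pmf ?M)"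
      by (intro bdd_above_finite finite_imageI finite_set_edge_pmf)
    then obtain b where b: "\<And>X. X \<in> set_pmf ?M \<Longrightarrow> ?f X \<le> b"
      by (auto simp: bdd_above_def)
    obtain m :: nat where m: "max (4 * b + 4) (real n + 2) \<le> m"
      using real_arch_simple by blast
    define W where "W X = mixture (1/200) (weight (1/40000) n) (configs m n) (direction n P Q) n (adj X) P" for X
    have risk: "?f X \<le> 800 * (?pen + ln (W X)) \<and> W X > 0" if "X \<in> set_pmf ?M" for X
    proof -
      obtain z c K L where "is_minimizer ?\<Psi> 1 400 n (adj X) z c K L"
          "is_blockwise_rank1 n (adj X) z c K L (R (adj X))"
        using sel[rule_format, of "adj X"] by (auto split: prod.splits)
      then show ?thesis
        unfolding W_def using b[OF that] m n
        by (intro conjI pathwise_risk_bound[OF n _ _ repr Q]) auto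
    qed
    have int: "integrable ?M f" for f :: "_ \<Rightarrow> real"
      by (rule integrable_measure_pmf_finite[OF finite_set_edge_pmf])
    have EW: "measure_pmf.expectation ?M W \<le> 1"
      unfolding W_def
      by (rule expectation_mixture_le_1)
         (use sym repr sum_weight_le_1[of "1/40000"] weight_pos[of "1/40000"]
           in \<open>auto simp: nbm_repr_def intro: less_imp_le\<close>)
    \<comment> \<open>Since \<open>ln (W X) \<le> W X\<close>, the expectation bound on
      \<open>W\<close> yields the additive constant 1, within the claimed 3.\<close>
    have "measure_pmf.expectation ?M ?f \<le> measure_pmf.expectation ?M (\<lambda>X. 800 * (?pen + W X))"
    proof (rule integral_mono_AE[OF int int], rule AE_pmfI)
      fix X assume X: "X \<in> set_pmf ?M"
      then have "ln (W X) \<le> W X"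
        using risk ln_bound by blast
      then show "?f X \<le> 800 * (?pen + W X)"
        using risk[OF X, THEN conjunct1] by argo
    qed
    also have "\<dots> = 800 * (?pen + measure_pmf.expectation ?M W)"
      by (simp add: int)
    also have "\<dots> \<le> 800 * (?pen + 3)"
      using EW by simp
    finally have E: "measure_pmf.expectation ?M ?f \<le> 800 * (?pen + 3)" .
    \<comment> \<open>Markov at level \<open>exp t\<close>: off that event
      \<open>ln (W X) \<le> t\<close>. This gives probability at least \<open>1 - exp (- t)\<close>,
      more than claimed.\<close>
    have "measure_pmf.prob ?M {X. ?f X \<le> 800 * (?pen + t)} \<ge> 1 - 3 * exp (- t)" for t
    proof -
      have "measure_pmf.prob ?M {X. exp t \<le> W X} \<le> measure_pmf.expectation ?M W / exp t"
        using integral_Markov_inequality_measure[OF int, of _ W "exp t"] risk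
        by (auto simp: AE_measure_pmf_iff intro: less_imp_le)
      also have "\<dots> \<le> 1 / exp t"
        using EW by (intro divide_right_mono) auto
      finally have tail: "measure_pmf.prob ?M {X. exp t \<le> W X} \<le> exp (- t)"
        by (simp add: exp_minus inverse_eq_divide)
      have "1 - exp (- t) \<le> measure_pmf.prob ?M {X. \<not> exp t \<le> W X}"
        using tail measure_pmf.prob_neg[of ?M "\<lambda>X. exp t \<le> W X"] by simp
      also have "\<dots> \<le> measure_pmf.prob ?M {X. ?f X \<le> 800 * (?pen + t)}"
      proof (rule measure_pmf.finite_measure_mono_AE, rule AE_pmfI)
        fix X assume X: "X \<in> set_pmf ?M"
        show "X \<in> {X. \<not> exp t \<le> W X} \<longrightarrow> X \<in> {X. ?f X \<le> 800 * (?pen + t)}"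
        proof
          assume "X \<in> {X. \<not> exp t \<le> W X}"
          then have "ln (W X) \<le> t"
            using risk[OF X] ln_le_cancel_iff[of "W X" "exp t"] by auto
          then show "X \<in> {X. ?f X \<le> 800 * (?pen + t)}"
            using risk[OF X] by auto
        qed
      qed simp
      finally show ?thesis
        using exp_gt_zero[of "- t"] by linarith
    qed
    then show ?thesis using E by blast
  qed
  have "0 < ?\<Psi>"
    using gauss_const_gt_1[of "1/40000"] by (simp add: add_pos_nonneg)
  then show ?thesis
    using main
    by (intro exI[of _ ?\<Psi>] exI[of _ 1] exI[of _ 400] exI[of _ 800]) (intro conjI allI impI; (elim conjE)?; simp; blast)
qed

end
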